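(* Let $(\mathcal{K},[\cdot,\cdot])$ be a Krein space. Then: (i) For all $\hat f,\hat g\in\mathcal{K}\times\mathcal{K}$, $$[\hat f,\hat g]_{\mathcal{K}^2}=\left[\begin{pmatrix}0&-i\\-i&0\end{pmatrix}\hat f,\hat g\right]_{\mathcal{K}\times\mathcal{K}}.$$ (ii) For a linear relation $A$ in $(\mathcal{K},[\cdot,\cdot])$ the following are equivalent: $A$ is symmetric; $A$ is a neutral manifold in $(\mathcal{K}^2,[\cdot,\cdot]_{\mathcal{K}^2})$; $A^{-1}\subseteq A^{[\perp]_{\mathcal{K}\times\mathcal{K}}}$. (iii) A linear relation $A$ in $(\mathcal{K},[\cdot,\cdot])$ is self-adjoint if and only if it is a hyper-maximal neutral subspace in $(\mathcal{K}^2,[\cdot,\cdot]_{\mathcal{K}^2})$; symbolically, $$A=A^+\iff A=A^{[\perp]_{\mathcal{K}^2}}\iff A^{-1}=A^{[\perp]_{\mathcal{K}\times\mathcal{K}}}.$$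
   Context: Inner products are linear in the first argument. For $\hat f=(f,f')$, $\hat g=(g,g')$ in $\mathcal{K}\times\mathcal{K}$ define two Krein space inner products: $[\hat f,\hat g]_{\mathcal{K}^2}:=-i[f',g]+i[f,g']$ and $[\hat f,\hat g]_{\mathcal{K}\times\mathcal{K}}:=[f,g]-[f',g']$. The corresponding orthogonal companions are denoted $[\perp]_{\mathcal{K}^2}$ and $[\perp]_{\mathcal{K}\times\mathcal{K}}$. In an inner product space a linear subspace $A$ is neutral if $A\subseteq A^{[\perp]}$ and hyper-maximal neutral if $A=A^{[\perp]}$. A linear relation in $\mathcal{K}$ is a linear subspace $A\subseteq\mathcal{K}\times\mathcal{K}$; $A^{-1}=\{(g,f):(f,g)\in A\}$; $A^+=\{(k,h)\in\mathcal{K}^2:[f,h]=[g,k]\ \forall(f,g)\in A\}$; $A$ is symmetric if $A\subseteq A^+$ and self-adjoint if $A=A^+$. *)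

theory Defs
  imports "HOL-Analysis.Analysis"
begin

text \<open>Complex scalar multiplication is a parameter, as in the library locale
  \<^locale>\<open>vector_space\<close>; the carrier of a space is a whole type.  An inner product is a
  possibly indefinite, possibly degenerate Hermitian sesquilinear form, linear in its
  first argument.\<close>

locale inner_product_space = vector_space cscale
  for cscale :: "complex \<Rightarrow> 'k::ab_group_add \<Rightarrow> 'k" +
  fixes ip :: "'k \<Rightarrow> 'k \<Rightarrow> complex"
  assumes ip_add_left: "ip (x + y) z = ip x z + ip y z"
    and ip_scale_left: "ip (cscale c x) y = c * ip x y"
    and ip_commute: "ip y x = cnj (ip x y)"

text \<open>On a positive definite subspace the form value of a vector with itself is real and
  nonnegative, so the distance is the usual norm distance; the modulus only makes the
  distance nonnegative off the subspace, as \<^locale>\<open>Metric_space\<close> requires.\<close>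

definition ip_dist :: "('k::ab_group_add \<Rightarrow> 'k \<Rightarrow> complex) \<Rightarrow> 'k \<Rightarrow> 'k \<Rightarrow> real"
  where "ip_dist ip x y = sqrt (cmod (ip (x - y) (x - y)))"

definition positive_definite_on :: "('k::ab_group_add \<Rightarrow> 'k \<Rightarrow> complex) \<Rightarrow> 'k set \<Rightarrow> bool"
  where "positive_definite_on ip H \<longleftrightarrow> (\<forall>x\<in>H. x \<noteq> 0 \<longrightarrow> 0 < Re (ip x x))"

definition hilbert_subspace ::
    "(complex \<Rightarrow> 'k::ab_group_add \<Rightarrow> 'k) \<Rightarrow> ('k \<Rightarrow> 'k \<Rightarrow> complex) \<Rightarrow> 'k set \<Rightarrow> bool"
  where "hilbert_subspace cscale ip H \<longleftrightarrow>
    module.subspace cscale H \<and> positive_definite_on ip H \<and>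
    Metric_space.mcomplete H (ip_dist ip)"

definition fundamental_decomposition ::
    "(complex \<Rightarrow> 'k::ab_group_add \<Rightarrow> 'k) \<Rightarrow> ('k \<Rightarrow> 'k \<Rightarrow> complex) \<Rightarrow> 'k set \<Rightarrow> 'k set \<Rightarrow> bool"
  where "fundamental_decomposition cscale ip Kp Km \<longleftrightarrow>
    hilbert_subspace cscale ip Kp \<and> hilbert_subspace cscale (\<lambda>x y. - ip x y) Km \<and>
    (\<forall>x\<in>Kp. \<forall>y\<in>Km. ip x y = 0) \<and>
    Kp \<inter> Km = {0} \<and> (\<forall>x. \<exists>p\<in>Kp. \<exists>m\<in>Km. x = p + m)"

locale krein_space = inner_product_space +
  assumes ex_fundamental_decomposition: "\<exists>Kp Km. fundamental_decomposition cscale ip Kp Km"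

definition orthogonal_companion :: "('v \<Rightarrow> 'v \<Rightarrow> complex) \<Rightarrow> 'v set \<Rightarrow> 'v set"
  where "orthogonal_companion ip A = {x. \<forall>a\<in>A. ip x a = 0}"

definition neutral ::
    "(complex \<Rightarrow> 'v::ab_group_add \<Rightarrow> 'v) \<Rightarrow> ('v \<Rightarrow> 'v \<Rightarrow> complex) \<Rightarrow> 'v set \<Rightarrow> bool"
  where "neutral cscale ip A \<longleftrightarrow>
    module.subspace cscale A \<and> A \<subseteq> orthogonal_companion ip A"

definition hyper_maximal_neutral ::
    "(complex \<Rightarrow> 'v::ab_group_add \<Rightarrow> 'v) \<Rightarrow> ('v \<Rightarrow> 'v \<Rightarrow> complex) \<Rightarrow> 'v set \<Rightarrow> bool"
  where "hyper_maximal_neutral cscale ip A \<longleftrightarrow>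
    module.subspace cscale A \<and> A = orthogonal_companion ip A"

abbreviation scale_sq ::
    "(complex \<Rightarrow> 'k::ab_group_add \<Rightarrow> 'k) \<Rightarrow> complex \<Rightarrow> 'k \<times> 'k \<Rightarrow> 'k \<times> 'k"
  where "scale_sq cscale \<equiv> module_prod.scale cscale cscale"

definition ip_K2 :: "('k \<Rightarrow> 'k \<Rightarrow> complex) \<Rightarrow> 'k \<times> 'k \<Rightarrow> 'k \<times> 'k \<Rightarrow> complex"
  where "ip_K2 ip = (\<lambda>(f, f') (g, g'). - \<i> * ip f' g + \<i> * ip f g')"

definition ip_KxK :: "('k \<Rightarrow> 'k \<Rightarrow> complex) \<Rightarrow> 'k \<times> 'k \<Rightarrow> 'k \<times> 'k \<Rightarrow> complex"
  where "ip_KxK ip = (\<lambda>(f, f') (g, g'). ip f g - ip f' g')"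

text \<open>The action of a block matrix whose entries are scalar multiples of the identity.\<close>

definition block_apply ::
    "(complex \<Rightarrow> 'k::ab_group_add \<Rightarrow> 'k) \<Rightarrow> complex^2^2 \<Rightarrow> 'k \<times> 'k \<Rightarrow> 'k \<times> 'k"
  where "block_apply cscale M = (\<lambda>(f, f').
    (cscale (M $ 1 $ 1) f + cscale (M $ 1 $ 2) f', cscale (M $ 2 $ 1) f + cscale (M $ 2 $ 2) f'))"

definition linear_relation ::
    "(complex \<Rightarrow> 'k::ab_group_add \<Rightarrow> 'k) \<Rightarrow> ('k \<times> 'k) set \<Rightarrow> bool"
  where "linear_relation cscale A \<longleftrightarrow> module.subspace (scale_sq cscale) A"

definition rel_adjoint :: "('k \<Rightarrow> 'k \<Rightarrow> complex) \<Rightarrow> ('k \<times> 'k) set \<Rightarrow> ('k \<times> 'k) set"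
  where "rel_adjoint ip A = {(k, h). \<forall>(f, g)\<in>A. ip f h = ip g k}"

definition symmetric_relation :: "('k \<Rightarrow> 'k \<Rightarrow> complex) \<Rightarrow> ('k \<times> 'k) set \<Rightarrow> bool"
  where "symmetric_relation ip A \<longleftrightarrow> A \<subseteq> rel_adjoint ip A"

definition self_adjoint_relation :: "('k \<Rightarrow> 'k \<Rightarrow> complex) \<Rightarrow> ('k \<times> 'k) set \<Rightarrow> bool"
  where "self_adjoint_relation ip A \<longleftrightarrow> A = rel_adjoint ip A"

text \<open>The distance used for completeness is indeed a metric on positive definite subspaces,
  and both forms on the square are inner products.\<close>

context inner_product_space
begin

lemma ip_add_right: "ip x (y + z) = ip x y + ip x z"
  using ip_add_left[of y z x] ip_commute by (metis complex_cnj_add)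

lemma ip_scale_right: "ip x (cscale c y) = cnj c * ip x y"
  using ip_scale_left[of c y x] ip_commute by (metis complex_cnj_mult)

lemma ip_zero: "ip 0 x = 0" "ip x 0 = 0"
  using ip_add_left[of 0 0 x] ip_add_right[of x 0 0] by auto

lemma ip_minus: "ip (- x) (- x) = ip x x"
  using ip_scale_left[of "-1" x] ip_scale_right[of _ "-1" x] by (simp add: scale_minus_left)

lemma ip_self_Im: "Im (ip x x) = 0"
  using arg_cong[OF ip_commute[of x x], of Im] by simp

lemma Re_ip_commute: "Re (ip y x) = Re (ip x y)"
  by (subst ip_commute) simp

lemma metric_ip_dist:
  assumes sub: "subspace H" and pd: "positive_definite_on ip H"
  shows "Metric_space H (ip_dist ip)"
proof -
  have nn: "0 \<le> Re (ip x x)" if "x \<in> H" for x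
    using pd that ip_zero(1)[of 0] unfolding positive_definite_on_def
    by (cases "x = 0") (auto simp: less_imp_le)
  have cm: "cmod (ip x x) = Re (ip x x)" if "x \<in> H" for x
    using nn[OF that] ip_self_Im[of x] by (simp add: cmod_eq_Re)
  have cs: "Re (ip x y) \<le> sqrt (Re (ip x x)) * sqrt (Re (ip y y))" if "x \<in> H" "y \<in> H" for x y
  proof (cases "y = 0")
    case True
    then show ?thesis using nn[OF that(1)] by (simp add: ip_zero)
  next
    case False
    define t where "t = - Re (ip x y) / Re (ip y y)"
    have p: "Re (ip y y) > 0" using pd that False by (auto simp: positive_definite_on_def)
    have "x + cscale (of_real t) y \<in> H"
      by (intro subspace_add[OF sub] subspace_scale[OF sub] that)
    from nn[OF this] have "0 \<le> Re (ip x x) + 2 * t * Re (ip x y) + t * t * Re (ip y y)"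
      using Re_ip_commute[of x y] ip_self_Im[of y]
      by (simp add: ip_add_left ip_add_right ip_scale_left ip_scale_right algebra_simps)
    also have "\<dots> = Re (ip x x) - (Re (ip x y))\<^sup>2 / Re (ip y y)"
      using p by (simp add: t_def field_simps power2_eq_square)
    finally have "(Re (ip x y))\<^sup>2 \<le> Re (ip x x) * Re (ip y y)"
      using p by (simp add: field_simps)
    then show ?thesis
      by (metis real_le_rsqrt real_sqrt_mult)
  qed
  have tri: "sqrt (Re (ip (x + y) (x + y))) \<le> sqrt (Re (ip x x)) + sqrt (Re (ip y y))"
    if "x \<in> H" "y \<in> H" for x y
  proof (rule real_le_lsqrt)
    show "Re (ip (x + y) (x + y)) \<le> (sqrt (Re (ip x x)) + sqrt (Re (ip y y)))\<^sup>2"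
      using cs[OF that] nn[OF that(1)] nn[OF that(2)] Re_ip_commute[of x y]
      by (simp add: power2_sum ip_add_left ip_add_right)
  qed (use nn that in auto)
  show ?thesis
  proof
    fix x y show "0 \<le> ip_dist ip x y" by (simp add: ip_dist_def)
    show "ip_dist ip x y = ip_dist ip y x"
      using ip_minus[of "x - y"] by (simp add: ip_dist_def)
  next
    fix x y assume "x \<in> H" "y \<in> H"
    then have d: "x - y \<in> H" by (rule subspace_diff[OF sub])
    show "ip_dist ip x y = 0 \<longleftrightarrow> x = y"
      using pd d by (auto simp: ip_dist_def ip_zero positive_definite_on_def)
  next
    fix x y z assume "x \<in> H" "y \<in> H" "z \<in> H"
    then have d: "x - y \<in> H" "y - z \<in> H" "x - z \<in> H" by (auto intro: subspace_diff[OF sub])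
    show "ip_dist ip x z \<le> ip_dist ip x y + ip_dist ip y z"
      using tri[OF d(1,2)] by (simp add: ip_dist_def cm d)
  qed
qed

lemma uminus_inner_product_space: "inner_product_space cscale (\<lambda>x y. - ip x y)"
  by unfold_locales (auto simp: ip_add_left ip_scale_left intro: ip_commute)

lemma
  shows ip_K2_inner_product_space: "inner_product_space (scale_sq cscale) (ip_K2 ip)"
    and ip_KxK_inner_product_space: "inner_product_space (scale_sq cscale) (ip_KxK ip)"
proof -
  interpret P: vector_space_prod cscale cscale ..
  show "inner_product_space (scale_sq cscale) (ip_K2 ip)"
  proof unfold_locales
    fix x y :: "'k \<times> 'k"
    show "ip_K2 ip y x = cnj (ip_K2 ip x y)"
      using ip_commute[of "fst x" "snd y"] ip_commute[of "snd x" "fst y"]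
      by (simp add: ip_K2_def split_beta)
  qed (auto simp: ip_K2_def P.scale_def ip_add_left ip_scale_left algebra_simps)
  show "inner_product_space (scale_sq cscale) (ip_KxK ip)"
  proof unfold_locales
    fix x y :: "'k \<times> 'k"
    show "ip_KxK ip y x = cnj (ip_KxK ip x y)"
      using ip_commute[of "fst x" "fst y"] ip_commute[of "snd x" "snd y"]
      by (simp add: ip_KxK_def split_beta)
  qed (auto simp: ip_KxK_def P.scale_def ip_add_left ip_scale_left algebra_simps)
qed

end

end

theory Submission
  imports Defs
begin

text \<open>Everything rests on reading the condition \<open>[f, h] = [g, k]\<close> that defines the adjoint
  \<open>A\<^sup>+\<close> as an orthogonality condition.  Conjugating it gives \<open>[k, g] = [h, f]\<close>, which says that
  \<open>(k, h)\<close> annihilates \<open>(f, g)\<close> in \<open>\<K>\<^sup>2\<close> (lemma \<open>orthogonal_companion_K2\<close>) and, equivalently, that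
  the flipped pair \<open>(h, k)\<close> annihilates \<open>(f, g)\<close> in \<open>\<K> \<times> \<K>\<close> (lemma
  \<open>orthogonal_companion_KxK\<close>).  So the companion of \<open>A\<close> in \<open>\<K>\<^sup>2\<close> is \<open>A\<^sup>+\<close>, the companion in
  \<open>\<K> \<times> \<K>\<close> is the inverse of \<open>A\<^sup>+\<close>, and since inversion of relations is an order
  isomorphism, inclusions and equalities with \<open>A\<^sup>+\<close> translate into those with either
  companion.\<close>

context inner_product_space
begin

text \<open>The flip in the block matrix turns \<open>(f, f')\<close> into \<open>(f', f)\<close>; the common factor \<open>- \<i>\<close> meets
  the minus sign of the form on \<open>\<K> \<times> \<K>\<close> in the second entry only, which produces the two
  opposite signs of the form on \<open>\<K>\<^sup>2\<close>.\<close>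

lemma ip_K2_eq_ip_KxK_block:
  "ip_K2 ip f g =
    ip_KxK ip (block_apply cscale (vector [vector [0, - \<i>], vector [- \<i>, 0]]) f) g"
proof -
  have "ip (cscale (- \<i>) x) y = - \<i> * ip x y" for x y
    by (rule ip_scale_left)
  \<comment> \<open>Rewriting \<open>cscale (- c) x\<close> to \<open>- cscale c x\<close> would hide the scalar from this equation.\<close>
  then show ?thesis
    by (simp add: ip_K2_def ip_KxK_def block_apply_def split_beta vector_2
        del: scale_minus_left)
qed

lemma ip_eq_ip_commute: "ip a b = ip c d \<longleftrightarrow> ip b a = ip d c"
  using ip_commute by metis

lemma orthogonal_companion_K2: "orthogonal_companion (ip_K2 ip) A = rel_adjoint ip A"
proof -
  have "ip_K2 ip (k, h) (f, g) = 0 \<longleftrightarrow> ip f h = ip g k" for k h f g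
  proof -
    have "ip_K2 ip (k, h) (f, g) = \<i> * (ip k g - ip h f)"
      by (simp add: ip_K2_def algebra_simps)
    then show ?thesis
      using ip_eq_ip_commute[of f h g k] by auto
  qed
  then show ?thesis
    unfolding orthogonal_companion_def rel_adjoint_def by auto
qed

lemma orthogonal_companion_KxK: "orthogonal_companion (ip_KxK ip) A = (rel_adjoint ip A)\<inverse>"
proof -
  have "ip_KxK ip (h, k) (f, g) = 0 \<longleftrightarrow> ip f h = ip g k" for k h f g
    using ip_eq_ip_commute[of f h g k] by (simp add: ip_KxK_def)
  then show ?thesis
    unfolding orthogonal_companion_def rel_adjoint_def by auto
qed

end

theorem proposition3p5:
  fixes cscale :: "complex \<Rightarrow> 'k::ab_group_add \<Rightarrow> 'k"
    and ip :: "'k \<Rightarrow> 'k \<Rightarrow> complex"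
  assumes "krein_space cscale ip"
  shows
    "(\<forall>f g. ip_K2 ip f g =
        ip_KxK ip (block_apply cscale (vector [vector [0, - \<i>], vector [- \<i>, 0]]) f) g) \<and>
     (\<forall>A. linear_relation cscale A \<longrightarrow>
        (symmetric_relation ip A \<longleftrightarrow> neutral (scale_sq cscale) (ip_K2 ip) A) \<and>
        (neutral (scale_sq cscale) (ip_K2 ip) A \<longleftrightarrow>
           A\<inverse> \<subseteq> orthogonal_companion (ip_KxK ip) A)) \<and>
     (\<forall>A. linear_relation cscale A \<longrightarrow>
        (self_adjoint_relation ip A \<longleftrightarrow> hyper_maximal_neutral (scale_sq cscale) (ip_K2 ip) A) \<and>
        (A = rel_adjoint ip A \<longleftrightarrow> A = orthogonal_companion (ip_K2 ip) A) \<and>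
        (A = orthogonal_companion (ip_K2 ip) A \<longleftrightarrow>
           A\<inverse> = orthogonal_companion (ip_KxK ip) A))"
proof -
  interpret krein_space cscale ip by fact
  show ?thesis
    using ip_K2_eq_ip_KxK_block
    unfolding orthogonal_companion_K2 orthogonal_companion_KxK symmetric_relation_def
      self_adjoint_relation_def neutral_def hyper_maximal_neutral_def linear_relation_def
      converse_mono converse_inject
    by blast
qed

end
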